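(* Let $p$ be a prime with $p\equiv 1\pmod 3$, $\mathcal{R}=\mathbb{F}_p+u\mathbb{F}_p+u^2\mathbb{F}_p+u^3\mathbb{F}_p$ with $u^4=u$, and $\xi\in\mathbb{F}_p$ a primitive cube root of unity. Let $\Psi:\mathcal{R}\to\mathbb{F}_p^4$ be $$\Psi(a+bu+cu^2+du^3)=(a,\ a+b+c+d,\ a+b\xi^2+c\xi+d,\ a+b\xi+c\xi^2+d),$$ extended componentwise to $\Psi:\mathcal{R}^n\to\mathbb{F}_p^{4n}$. Then $\Psi$ is an $\mathbb{F}_p$-linear bijection; if $\mathcal{C}$ is a self-dual code over $\mathcal{R}$ then $\Psi(\mathcal{C})$ is a self-dual code in $\mathbb{F}_p^{4n}$; and $\Psi$ is distance preserving from $(\mathcal{R}^n,d_{G_\Psi})$ to $(\mathbb{F}_p^{4n},$ Hamming distance$)$.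
   Context: For $r\in\mathcal{R}^n$ the Gray weight is $w_{G_\Psi}(r)=w_H(\Psi(r))$ (Hamming weight) and the Gray distance is $d_{G_\Psi}(r,s)=w_{G_\Psi}(r-s)$. Codes over $\mathcal{R}$ are $\mathcal{R}$-submodules of $\mathcal{R}^n$; self-dual means $C=C^\perp$ with respect to the Euclidean inner product (over $\mathcal{R}$, resp. $\mathbb{F}_p$). *)

theory Defs
  imports
    "Berlekamp_Zassenhaus.Finite_Field"
    "Jordan_Normal_Form.VS_Connect"
begin

text \<open>
  The ring \<open>K + uK + u^2 K + u^3 K\<close> with \<open>u^4 = u\<close>: the element
  \<open>a + bu + cu^2 + du^3\<close> is \<open>UR a b c d\<close>.
\<close>

datatype 'a uring = UR 'a 'a 'a 'a

instantiation uring :: (comm_ring_1) comm_ring_1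
begin

definition "0 = UR 0 0 0 0"

definition "1 = UR 1 0 0 0"

fun plus_uring :: "'a uring \<Rightarrow> 'a uring \<Rightarrow> 'a uring" where
  "UR a b c d + UR a' b' c' d' = UR (a + a') (b + b') (c + c') (d + d')"

fun uminus_uring :: "'a uring \<Rightarrow> 'a uring" where
  "- UR a b c d = UR (- a) (- b) (- c) (- d)"

fun minus_uring :: "'a uring \<Rightarrow> 'a uring \<Rightarrow> 'a uring" where
  "UR a b c d - UR a' b' c' d' = UR (a - a') (b - b') (c - c') (d - d')"

text \<open>Polynomial multiplication reduced by \<open>u^4 = u\<close>, \<open>u^5 = u^2\<close>, \<open>u^6 = u^3\<close>.\<close>

fun times_uring :: "'a uring \<Rightarrow> 'a uring \<Rightarrow> 'a uring" where
  "UR a b c d * UR a' b' c' d' = UR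
     (a * a')
     (a * b' + b * a' + (b * d' + c * c' + d * b'))
     (a * c' + b * b' + c * a' + (c * d' + d * c'))
     (a * d' + b * c' + c * b' + d * a' + d * d')"

instance
proof
  fix x y z :: "'a uring"
  show "x * y * z = x * (y * z)"
    by (cases x; cases y; cases z) (simp add: algebra_simps)
  show "x * y = y * x"
    by (cases x; cases y) (simp add: algebra_simps)
  show "(x + y) * z = x * z + y * z"
    by (cases x; cases y; cases z) (simp add: algebra_simps)
  show "x + y + z = x + (y + z)"
    by (cases x; cases y; cases z) (simp add: algebra_simps)
  show "x + y = y + x"
    by (cases x; cases y) (simp add: algebra_simps)
  show "x - y = x + - y"
    by (cases x; cases y) simp
  show "1 * x = x" "0 + x = x" "- x + x = 0"
    by (cases x; simp add: zero_uring_def one_uring_def)+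
  show "(0 :: 'a uring) \<noteq> 1"
    by (simp add: zero_uring_def one_uring_def)
qed

end

definition uconst :: "'a :: comm_ring_1 \<Rightarrow> 'a uring" where
  "uconst a = UR a 0 0 0"

definition u_gen :: "'a :: comm_ring_1 uring" where
  "u_gen = UR 0 1 0 0"

lemma u_gen_power4: "u_gen ^ 4 = (u_gen :: 'a :: comm_ring_1 uring)"
  by (simp add: u_gen_def eval_nat_numeral one_uring_def)

lemma UR_eq: "UR a b c d =
  uconst a + u_gen * uconst b + u_gen ^ 2 * uconst c + u_gen ^ 3 * uconst (d :: 'a :: comm_ring_1)"
  by (simp add: u_gen_def uconst_def eval_nat_numeral one_uring_def)

lemma uconst_ring_hom:
  "uconst 0 = 0" "uconst 1 = 1"
  "uconst (a + b) = uconst a + uconst b" "uconst (a * b) = uconst a * uconst b"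
  by (simp_all add: uconst_def zero_uring_def one_uring_def)

definition primitive_root_of_unity :: "nat \<Rightarrow> 'a :: monoid_mult \<Rightarrow> bool" where
  "primitive_root_of_unity k z \<longleftrightarrow> 0 < k \<and> z ^ k = 1 \<and> (\<forall>j. 0 < j \<and> j < k \<longrightarrow> z ^ j \<noteq> 1)"

fun gray4 :: "'a \<Rightarrow> 'a uring \<Rightarrow> 'a :: comm_ring_1 vec" where
  "gray4 \<xi> (UR a b c d) = vec_of_list
     [a,
      a + b + c + d,
      a + b * \<xi> ^ 2 + c * \<xi> + d,
      a + b * \<xi> + c * \<xi> ^ 2 + d]"

text \<open>The image of \<open>(r\<^sub>1, \<dots>, r\<^sub>n)\<close> is the concatenation of the blocks \<open>gray4 \<xi> r\<^sub>j\<close>.\<close>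

definition gray :: "'a \<Rightarrow> 'a uring vec \<Rightarrow> 'a :: comm_ring_1 vec" where
  "gray \<xi> r = vec (4 * dim_vec r) (\<lambda>i. gray4 \<xi> (r $ (i div 4)) $ (i mod 4))"

definition hamming_weight :: "'a :: zero vec \<Rightarrow> nat" where
  "hamming_weight v = card {i. i < dim_vec v \<and> v $ i \<noteq> 0}"

text \<open>Only meaningful for vectors of equal dimension.\<close>

definition hamming_dist :: "'a vec \<Rightarrow> 'a vec \<Rightarrow> nat" where
  "hamming_dist v w = card {i. i < dim_vec v \<and> v $ i \<noteq> w $ i}"

definition gray_weight :: "'a :: comm_ring_1 \<Rightarrow> 'a uring vec \<Rightarrow> nat" where
  "gray_weight \<xi> r = hamming_weight (gray \<xi> r)"

definition gray_dist :: "'a :: comm_ring_1 \<Rightarrow> 'a uring vec \<Rightarrow> 'a uring vec \<Rightarrow> nat" where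
  "gray_dist \<xi> r s = gray_weight \<xi> (r - s)"

definition linear_code :: "nat \<Rightarrow> 'a :: comm_ring_1 vec set \<Rightarrow> bool" where
  "linear_code n C \<longleftrightarrow> LinearCombinations.submodule class_ring C (module_vec TYPE('a) n)"

definition dual_code :: "nat \<Rightarrow> 'a :: comm_ring_1 vec set \<Rightarrow> 'a vec set" where
  "dual_code n C = {v \<in> carrier_vec n. \<forall>w \<in> C. v \<bullet> w = 0}"

definition self_dual_code :: "nat \<Rightarrow> 'a :: comm_ring_1 vec set \<Rightarrow> bool" where
  "self_dual_code n C \<longleftrightarrow> linear_code n C \<and> C = dual_code n C"

definition regular_module :: "('a :: comm_ring_1, 'a) module" where
  "regular_module = \<lparr>carrier = UNIV, monoid.mult = (*), one = 1, zero = 0, add = (+), module.smult = (*)\<rparr>"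

definition restrict_scalars :: "('k \<Rightarrow> 'r) \<Rightarrow> ('r, 'm) module \<Rightarrow> ('k, 'm) module" where
  "restrict_scalars h M =
     \<lparr>carrier = carrier M, monoid.mult = monoid.mult M, one = one M, zero = zero M, add = add M,
      module.smult = (\<lambda>a. module.smult M (h a))\<rparr>"

end

theory Submission
  imports Defs
begin

text \<open>
  The entries of \<open>\<Psi>(r)\<close> are the values of the polynomial \<open>r\<close> at the four roots
  \<open>0, 1, \<xi>\<^sup>2, \<xi>\<close> of \<open>u^4 - u\<close>, so by the Chinese remainder theorem \<open>\<Psi>\<close> is a ring isomorphism
  from \<open>\<R>\<close> onto \<open>\<F>\<^sub>p^4\<close> with the componentwise product. Hence \<open>\<Psi>(r) \<bullet> \<Psi>(s)\<close> is the sum of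
  the four entries of \<open>\<Psi>(r \<bullet> s)\<close>. This gives self-orthogonality of \<open>\<Psi>(C)\<close>. Conversely, if
  \<open>\<Psi>(r)\<close> is orthogonal to \<open>\<Psi>(C)\<close>, then replacing \<open>w \<in> C\<close> by its multiples by the idempotents of
  \<open>\<R>\<close> shows that each entry of \<open>\<Psi>(r \<bullet> w)\<close> vanishes separately, whence \<open>r \<in> C\<^sup>\<bottom> = C\<close>.
\<close>

section \<open>Arithmetic of a primitive cube root of unity\<close>

text \<open>Primitivity excludes \<open>\<xi> = 1\<close>, so \<open>\<xi>\<close> is a root of the
  cofactor of \<open>X - 1\<close> in \<open>X^3 - 1\<close>. In characteristic 3 that cofactor is
  \<open>(X - 1)^2\<close>, which would force \<open>\<xi> = 1\<close> after all. The second claim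
  permits the division by 3 in the inverse map.\<close>

lemma primitive_cube_root:
  fixes \<xi> :: "'a :: field"
  assumes "primitive_root_of_unity 3 \<xi>"
  shows "\<xi> ^ 2 = - 1 - \<xi>" and "(3 :: 'a) \<noteq> 0"
proof -
  have ne: "\<xi> \<noteq> 1"
    using assms by (auto simp: primitive_root_of_unity_def dest!: spec[of _ 1])
  have "(\<xi> - 1) * (\<xi> ^ 2 + \<xi> + 1) = \<xi> ^ 3 - 1"
    by (simp add: algebra_simps power2_eq_square power3_eq_cube)
  then have "\<xi> ^ 2 + \<xi> + 1 = 0"
    using assms ne by (simp add: primitive_root_of_unity_def)
  then show sq: "\<xi> ^ 2 = - 1 - \<xi>"
    by (metis diff_eq_eq eq_neg_iff_add_eq_0)
  show "(3 :: 'a) \<noteq> 0"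
  proof
    assume three: "(3 :: 'a) = 0"
    have "(\<xi> - 1) ^ 2 = \<xi> ^ 2 + \<xi> + 1 - 3 * \<xi>"
      by (simp only: power2_diff) simp
    also have "\<dots> = 0"
      by (simp only: three sq) simp
    finally have "(\<xi> - 1) ^ 2 = 0" .
    then show False
      using ne by simp
  qed
qed

text \<open>Rewrite rules that bring right-nested polynomials in \<open>\<xi>\<close> to degree at
  most 1.\<close>

lemma cube_root_reduce:
  fixes \<xi> :: "'a :: comm_ring_1"
  assumes "\<xi> ^ 2 = - 1 - \<xi>"
  shows "\<xi> * \<xi> = - 1 - \<xi>" "\<xi> * (\<xi> * z) = - z - \<xi> * z"
  using assms by (simp_all add: power2_eq_square left_diff_distrib flip: mult.assoc)

lemma less_4_cases:
  fixes k :: nat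
  assumes "k < 4"
  obtains "k = 0" | "k = 1" | "k = 2" | "k = 3"
proof -
  have "k = 0 \<or> k = 1 \<or> k = 2 \<or> k = 3"
    using assms by linarith
  then show thesis
    using that by blast
qed

section \<open>The map \<open>gray4\<close> on one ring element and its inverse\<close>

lemma dim_gray4 [simp]: "dim_vec (gray4 \<xi> x) = 4"
  by (cases x) (simp del: vec_of_list_Cons)

lemma gray4_carrier [simp]: "gray4 \<xi> x \<in> carrier_vec 4"
  by (rule carrier_vecI) (rule dim_gray4)

lemma gray4_index:
  "gray4 \<xi> (UR a b c d) $ 0 = a"
  "gray4 \<xi> (UR a b c d) $ 1 = a + b + c + d"
  "gray4 \<xi> (UR a b c d) $ 2 = a + b * \<xi> ^ 2 + c * \<xi> + d"
  "gray4 \<xi> (UR a b c d) $ 3 = a + b * \<xi> + c * \<xi> ^ 2 + d"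
  by (simp_all add: vec_of_list_index del: vec_of_list_Cons)

lemma gray4_add_index:
  assumes "k < 4"
  shows "gray4 \<xi> (x + y) $ k = gray4 \<xi> x $ k + gray4 \<xi> y $ k"
  using assms
  by (cases x; cases y; elim less_4_cases; simp only: plus_uring.simps gray4_index)
    (simp_all add: algebra_simps)

lemma gray4_diff_index:
  assumes "k < 4"
  shows "gray4 \<xi> (x - y) $ k = gray4 \<xi> x $ k - gray4 \<xi> y $ k"
  using gray4_add_index[OF assms, of \<xi> "x - y" y] by simp

lemma gray4_uconst_index:
  assumes "k < 4"
  shows "gray4 \<xi> (uconst a) $ k = a"
  using assms unfolding uconst_def
  by (elim less_4_cases; simp only: gray4_index) simp_all

lemma gray4_zero_index:
  assumes "k < 4"
  shows "gray4 \<xi> 0 $ k = 0"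
  using gray4_uconst_index[OF assms, of \<xi> 0] by (simp add: uconst_ring_hom)

text \<open>Each entry evaluates a polynomial at 0, 1, \<open>\<xi>^2\<close> or
  \<open>\<xi>\<close>. All four points satisfy \<open>t^4 = t\<close>, so evaluation respects the
  reduction by \<open>u^4 = u\<close>.\<close>

lemma gray4_mult_index:
  assumes \<xi>: "\<xi> ^ 3 = 1" and "k < 4"
  shows "gray4 \<xi> (x * y) $ k = gray4 \<xi> x $ k * gray4 \<xi> y $ k"
proof -
  \<comment> \<open>The cube relation in the two shapes met in right-nested products: alone and
    followed by a further factor.\<close>
  have c: "\<xi> * (\<xi> * \<xi>) = 1" "\<And>z. \<xi> * (\<xi> * (\<xi> * z)) = z"
    using \<xi> by (simp_all add: power3_eq_cube mult.assoc[symmetric])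
  show ?thesis
    using assms(2)
    by (cases x; cases y; elim less_4_cases; simp only: times_uring.simps gray4_index)
      (simp_all add: algebra_simps power2_eq_square c)
qed

lemma gray4_sum_index:
  assumes "k < 4"
  shows "gray4 \<xi> (sum f A) $ k = (\<Sum>a\<in>A. gray4 \<xi> (f a) $ k)"
  using assms
  by (induction A rule: infinite_finite_induct) (simp_all add: gray4_zero_index gray4_add_index)

text \<open>
  Up to order, the last three entries minus the first form the discrete Fourier transform of
  length 3 of the coefficients of \<open>u, u^2, u^3\<close>; this is Fourier inversion.
\<close>

definition gray4_inv :: "'a \<Rightarrow> 'a :: field vec \<Rightarrow> 'a uring" where
  "gray4_inv \<xi> v =
    (let p = v $ 1 - v $ 0; q = v $ 2 - v $ 0; r = v $ 3 - v $ 0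
     in UR (v $ 0) ((p + \<xi> * q + \<xi> ^ 2 * r) / 3) ((p + \<xi> ^ 2 * q + \<xi> * r) / 3) ((p + q + r) / 3))"

lemma gray4_inv_gray4:
  fixes \<xi> :: "'a :: field"
  assumes "primitive_root_of_unity 3 \<xi>"
  shows "gray4_inv \<xi> (gray4 \<xi> x) = x"
proof (cases x)
  case (UR a b c d)
  note \<xi> = primitive_cube_root[OF assms]
  let ?p = "(a + b + c + d) - a"
  let ?q = "(a + b * \<xi> ^ 2 + c * \<xi> + d) - a"
  let ?r = "(a + b * \<xi> + c * \<xi> ^ 2 + d) - a"
  \<comment> \<open>In each combination \<open>1 + \<xi> + \<xi>^2 = 0\<close> cancels two of the
    coefficients \<open>b\<close>, \<open>c\<close>, \<open>d\<close>, and the third is counted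
    three times.\<close>
  have "?p + \<xi> * ?q + \<xi> ^ 2 * ?r = b * 3" "?p + \<xi> ^ 2 * ?q + \<xi> * ?r = c * 3"
    "?p + ?q + ?r = d * 3"
    by (simp_all add: algebra_simps power2_eq_square cube_root_reduce[OF \<xi>(1)])
  then show ?thesis
    using \<xi>(2) unfolding UR gray4_inv_def gray4_index Let_def uring.inject
    by (simp only: nonzero_mult_div_cancel_right simp_thms not_False_eq_True)
qed

lemma gray4_gray4_inv:
  fixes \<xi> :: "'a :: field"
  assumes "primitive_root_of_unity 3 \<xi>" and "v \<in> carrier_vec 4"
  shows "gray4 \<xi> (gray4_inv \<xi> v) = v"
proof (rule eq_vecI)
  note \<xi> = primitive_cube_root[OF assms(1)]
  define p q r where "p = v $ 1 - v $ 0" and "q = v $ 2 - v $ 0" and "r = v $ 3 - v $ 0"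
  note pqr = p_def q_def r_def
  note sq = cube_root_reduce[OF \<xi>(1)]
  let ?b = "p + \<xi> * q + \<xi> ^ 2 * r" and ?c = "p + \<xi> ^ 2 * q + \<xi> * r" and ?d = "p + q + r"
  have inv: "gray4_inv \<xi> v = UR (v $ 0) (?b / 3) (?c / 3) (?d / 3)"
    by (simp only: gray4_inv_def Let_def pqr)
  have cancel: "x * 3 / 3 = x" for x :: 'a
    using \<xi>(2) by simp
  have comb: "a + x / 3 * y + z / 3 * w + u / 3 = a + (x * y + z * w + u) / 3" for a x y z w u :: 'a
    by (simp add: add_divide_distrib)
  \<comment> \<open>The transform of the unnormalised coefficients: again two of \<open>p\<close>,
    \<open>q\<close>, \<open>r\<close> cancel. The factors 1 in the first identity give it the shape
    that \<open>comb\<close> produces.\<close>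
  have sum1: "?b * 1 + ?c * 1 + ?d = p * 3"
    and sum2: "?b * \<xi> ^ 2 + ?c * \<xi> + ?d = q * 3"
    and sum3: "?b * \<xi> + ?c * \<xi> ^ 2 + ?d = r * 3"
    by (simp_all add: algebra_simps power2_eq_square sq)
  fix k assume "k < dim_vec v"
  then have "k < 4"
    using assms(2) by simp
  then show "gray4 \<xi> (gray4_inv \<xi> v) $ k = v $ k"
  proof (cases rule: less_4_cases)
    case 1
    then show ?thesis by (simp only: inv gray4_index)
  next
    case 2
    have "gray4 \<xi> (gray4_inv \<xi> v) $ 1 = v $ 0 + p"
      using comb[of "v $ 0" ?b 1 ?c 1 ?d] unfolding inv gray4_index sum1 cancel by simp
    then show ?thesis using 2 by (simp add: pqr)
  next
    case 3
    have "gray4 \<xi> (gray4_inv \<xi> v) $ 2 = v $ 0 + q"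
      unfolding inv gray4_index comb sum2 cancel ..
    then show ?thesis using 3 by (simp add: pqr)
  next
    case 4
    have "gray4 \<xi> (gray4_inv \<xi> v) $ 3 = v $ 0 + r"
      unfolding inv gray4_index comb sum3 cancel ..
    then show ?thesis using 4 by (simp add: pqr)
  qed
qed (use assms(2) in simp)

lemma bij_betw_gray4:
  fixes \<xi> :: "'a :: field"
  assumes "primitive_root_of_unity 3 \<xi>"
  shows "bij_betw (gray4 \<xi>) UNIV (carrier_vec 4)"
  by (rule bij_betw_byWitness[where f' = "gray4_inv \<xi>"])
    (auto simp: gray4_inv_gray4[OF assms] gray4_gray4_inv[OF assms])

section \<open>Blockwise extension to vectors\<close>

lemma gray_carrier [simp]: "r \<in> carrier_vec n \<Longrightarrow> gray \<xi> r \<in> carrier_vec (4 * n)"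
  by (simp add: gray_def)

lemma gray_index:
  assumes "r \<in> carrier_vec n" "i < 4 * n"
  shows "gray \<xi> r $ i = gray4 \<xi> (r $ (i div 4)) $ (i mod 4)"
  using assms by (simp add: gray_def)

lemma gray_add:
  assumes "r \<in> carrier_vec n" "s \<in> carrier_vec n"
  shows "gray \<xi> (r + s) = gray \<xi> r + gray \<xi> s"
  using assms by (auto simp: gray_def gray4_add_index)

lemma gray_diff:
  assumes "r \<in> carrier_vec n" "s \<in> carrier_vec n"
  shows "gray \<xi> (r - s) = gray \<xi> r - gray \<xi> s"
  using assms by (auto simp: gray_def gray4_diff_index)

text \<open>\<open>uconst a\<close> is a constant polynomial, so it evaluates to \<open>a\<close> at
  every point; multiplicativity of the entries does the rest.\<close>

lemma gray_smult:
  assumes "\<xi> ^ 3 = 1"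
  shows "gray \<xi> (uconst a \<cdot>\<^sub>v r) = a \<cdot>\<^sub>v gray \<xi> r"
  by (auto simp: gray_def gray4_mult_index[OF assms] gray4_uconst_index)

lemma gray_zero: "gray \<xi> (0\<^sub>v n) = 0\<^sub>v (4 * n)"
  by (auto simp: gray_def gray4_zero_index)

lemma bij_betw_gray:
  fixes \<xi> :: "'a :: field"
  assumes "primitive_root_of_unity 3 \<xi>"
  shows "bij_betw (gray \<xi>) (carrier_vec n) (carrier_vec (4 * n))"
\<comment> \<open>The witness cuts a vector into blocks of length 4 and inverts each block;
  \<open>4 * j + k\<close> undoes the splitting of an index by \<open>div\<close> and
  \<open>mod\<close>.\<close>
proof (rule bij_betw_byWitness
    [where f' = "\<lambda>v. vec n (\<lambda>j. gray4_inv \<xi> (vec 4 (\<lambda>k. v $ (4 * j + k))))"])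
  show "\<forall>r \<in> carrier_vec n.
      vec n (\<lambda>j. gray4_inv \<xi> (vec 4 (\<lambda>k. gray \<xi> r $ (4 * j + k)))) = r"
  proof
    fix r :: "'a uring vec" assume r: "r \<in> carrier_vec n"
    have "vec 4 (\<lambda>k. gray \<xi> r $ (4 * j + k)) = gray4 \<xi> (r $ j)" if "j < n" for j
      using r that by (auto simp: gray_index)
    then show "vec n (\<lambda>j. gray4_inv \<xi> (vec 4 (\<lambda>k. gray \<xi> r $ (4 * j + k)))) = r"
      using r by (auto simp: gray4_inv_gray4[OF assms])
  qed
  show "\<forall>v \<in> carrier_vec (4 * n).
      gray \<xi> (vec n (\<lambda>j. gray4_inv \<xi> (vec 4 (\<lambda>k. v $ (4 * j + k))))) = v"
    by (auto simp: gray_def gray4_gray4_inv[OF assms])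
qed auto

text \<open>By multiplicativity, the entrywise product of two blocks is the block of a product in
  the ring. Collecting entries by their position within the block and using additivity gathers them
  into the single ring element \<open>r \<bullet> s\<close>.\<close>

lemma gray_scalar_prod:
  assumes \<xi>: "\<xi> ^ 3 = 1" and r: "r \<in> carrier_vec n" and s: "s \<in> carrier_vec n"
  shows "gray \<xi> r \<bullet> gray \<xi> s = (\<Sum>k<4. gray4 \<xi> (r \<bullet> s) $ k)"
proof -
  let ?g = "\<lambda>j k. gray4 \<xi> (r $ j * s $ j) $ k"
  \<comment> \<open>The bound is written \<open>n * 4\<close> to fit the grouping into
    \<open>n\<close> blocks that follows.\<close>
  have "gray \<xi> r \<bullet> gray \<xi> s = (\<Sum>i<n * 4. ?g (i div 4) (i mod 4))"
    using r s unfolding scalar_prod_def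
    by (intro sum.cong) (auto simp: gray_def gray4_mult_index[OF \<xi>])
  also have "\<dots> = (\<Sum>j<n. \<Sum>i = j * 4..<j * 4 + 4. ?g (i div 4) (i mod 4))"
    by (rule sum.nat_group[symmetric])
  also have "\<dots> = (\<Sum>j<n. \<Sum>k<4. ?g j k)"
  proof (rule sum.cong[OF refl])
    fix j
    have "(\<Sum>i = j * 4..<j * 4 + 4. ?g (i div 4) (i mod 4)) =
        (\<Sum>k = 0..<4. ?g ((k + j * 4) div 4) ((k + j * 4) mod 4))"
      using sum.shift_bounds_nat_ivl[of "\<lambda>i. ?g (i div 4) (i mod 4)" 0 "j * 4" 4]
      by (simp add: add.commute)
    then show "(\<Sum>i = j * 4..<j * 4 + 4. ?g (i div 4) (i mod 4)) = (\<Sum>k<4. ?g j k)"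
      by (simp add: atLeast0LessThan)
  qed
  also have "\<dots> = (\<Sum>k<4. \<Sum>j<n. ?g j k)"
    by (rule sum.swap)
  also have "\<dots> = (\<Sum>k<4. gray4 \<xi> (r \<bullet> s) $ k)"
    using s by (simp add: scalar_prod_def gray4_sum_index atLeast0LessThan)
  finally show ?thesis .
qed

section \<open>Vector space structures and linearity over the base field\<close>

lemma restrict_scalars_simps:
  "carrier (restrict_scalars h M) = carrier M"
  "add (restrict_scalars h M) = add M"
  "zero (restrict_scalars h M) = zero M"
  "module.smult (restrict_scalars h M) a = module.smult M (h a)"
  by (simp_all add: restrict_scalars_def)

lemma regular_module_simps:
  "carrier regular_module = UNIV"
  "add regular_module = (+)"
  "zero regular_module = 0"
  "module.smult regular_module = (*)"
  by (simp_all add: regular_module_def)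

lemma vectorspace_restrict_uconst_regular:
  "vectorspace class_ring
     (restrict_scalars uconst (regular_module :: ('a :: field uring, 'a uring) module))"
  by unfold_locales
    \<comment> \<open>Negatives are the witnesses for invertibility in the additive monoid.\<close>
    (auto simp: restrict_scalars_simps regular_module_simps class_ring_simps uconst_ring_hom
      algebra_simps Units_def intro!: exI[of _ "- _"])

lemma vectorspace_restrict_uconst_vec:
  "vectorspace class_ring
     (restrict_scalars uconst (module_vec TYPE('a :: field uring) n))"
  by unfold_locales
    (auto simp: restrict_scalars_simps module_vec_simps class_ring_simps uconst_ring_hom
      add_smult_distrib_vec smult_add_distrib_vec smult_smult_assoc Units_def
      intro!: bexI[of _ "- _"])

lemma module_module_vec: "Module.module class_ring (module_vec TYPE('a :: comm_ring_1) n)"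
  by unfold_locales
    (auto simp: module_vec_simps class_ring_simps add_smult_distrib_vec smult_add_distrib_vec
      Units_def intro!: bexI[of _ "- _"])

lemma vectorspace_vec: "vectorspace class_ring (module_vec TYPE('a :: field) n)"
  using module_module_vec class_field by (rule vectorspace.intro)

lemma linear_mapI:
  assumes "vectorspace K V" "vectorspace K W" "f \<in> module_hom K V W"
  shows "linear_map K V W f"
  using assms
  by (intro linear_map.intro mod_hom.intro mod_hom_axioms.intro) (auto simp: vectorspace_def)

lemma linear_map_gray4:
  fixes \<xi> :: "'a :: field"
  assumes "\<xi> ^ 3 = 1"
  shows "linear_map class_ring
           (restrict_scalars uconst (regular_module :: ('a uring, 'a uring) module))
           (module_vec TYPE('a) 4) (gray4 \<xi>)"
  by (rule linear_mapI[OF vectorspace_restrict_uconst_regular vectorspace_vec])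
    (auto simp: module_hom_def restrict_scalars_simps regular_module_simps module_vec_simps
      gray4_add_index gray4_mult_index[OF assms] gray4_uconst_index)

lemma linear_map_gray:
  fixes \<xi> :: "'a :: field"
  assumes "\<xi> ^ 3 = 1"
  shows "linear_map class_ring (restrict_scalars uconst (module_vec TYPE('a uring) n))
           (module_vec TYPE('a) (4 * n)) (gray \<xi>)"
  by (rule linear_mapI[OF vectorspace_restrict_uconst_vec vectorspace_vec])
    (auto simp: module_hom_def restrict_scalars_simps module_vec_simps
      gray_add gray_smult[OF assms])

section \<open>Linear codes and duality\<close>

lemma linear_code_iff:
  "linear_code n C \<longleftrightarrow> C \<subseteq> carrier_vec n \<and> 0\<^sub>v n \<in> C \<and>
     (\<forall>v \<in> C. \<forall>w \<in> C. v + w \<in> C) \<and> (\<forall>c. \<forall>v \<in> C. c \<cdot>\<^sub>v v \<in> C)"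
  by (auto simp: linear_code_def LinearCombinations.submodule_def module_vec_simps
      intro: module_module_vec)

lemma self_dual_gray:
  fixes \<xi> :: "'a :: field"
  assumes \<xi>: "primitive_root_of_unity 3 \<xi>" and C: "self_dual_code n C"
  shows "self_dual_code (4 * n) (gray \<xi> ` C)"
proof -
  have cube: "\<xi> ^ 3 = 1"
    using \<xi> by (simp add: primitive_root_of_unity_def)
  have sub: "C \<subseteq> carrier_vec n" and zero: "0\<^sub>v n \<in> C"
    and add: "\<And>v w. v \<in> C \<Longrightarrow> w \<in> C \<Longrightarrow> v + w \<in> C"
    and smult: "\<And>c v. v \<in> C \<Longrightarrow> c \<cdot>\<^sub>v v \<in> C"
    using C by (auto simp: self_dual_code_def linear_code_iff)
  have dual: "C = dual_code n C"
    using C by (simp add: self_dual_code_def)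
  have "linear_code (4 * n) (gray \<xi> ` C)"
    unfolding linear_code_iff
  proof (intro conjI ballI allI)
    show "gray \<xi> ` C \<subseteq> carrier_vec (4 * n)"
      using sub by auto
    show "0\<^sub>v (4 * n) \<in> gray \<xi> ` C"
      using zero gray_zero by (metis image_eqI)
  next
    fix v w assume "v \<in> gray \<xi> ` C" "w \<in> gray \<xi> ` C"
    then show "v + w \<in> gray \<xi> ` C"
      using sub add by (auto intro!: image_eqI gray_add[symmetric])
  next
    fix c v assume "v \<in> gray \<xi> ` C"
    then show "c \<cdot>\<^sub>v v \<in> gray \<xi> ` C"
      using smult by (auto intro!: image_eqI gray_smult[OF cube, symmetric])
  qed
  moreover have "gray \<xi> ` C \<subseteq> dual_code (4 * n) (gray \<xi> ` C)"
  proof -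
    have "gray \<xi> v \<bullet> gray \<xi> w = 0" if "v \<in> C" "w \<in> C" for v w
    proof -
      have "v \<bullet> w = 0"
        using that dual by (auto simp: dual_code_def)
      moreover have "v \<in> carrier_vec n" "w \<in> carrier_vec n"
        using that sub by auto
      ultimately show ?thesis
        by (simp add: gray_scalar_prod[OF cube] gray4_zero_index)
    qed
    then show ?thesis
      using sub by (auto simp: dual_code_def)
  qed
  moreover have "dual_code (4 * n) (gray \<xi> ` C) \<subseteq> gray \<xi> ` C"
  proof
    fix x assume x: "x \<in> dual_code (4 * n) (gray \<xi> ` C)"
    \<comment> \<open>Surjectivity of \<open>gray\<close> turns a vector of the dual into the image
      of some \<open>v\<close>, so the orthogonality can be studied over the ring.\<close>
    then obtain v where v: "v \<in> carrier_vec n" and xv: "x = gray \<xi> v"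
      using bij_betw_gray[OF \<xi>, of n] by (auto simp: dual_code_def bij_betw_def)
    have "v \<bullet> w = 0" if w: "w \<in> C" for w
    proof -
      have wn: "w \<in> carrier_vec n"
        using w sub by auto
      have "gray4 \<xi> (v \<bullet> w) $ k = 0" if k: "k < 4" for k
      proof -
        \<comment> \<open>The idempotent that evaluates to 1 at the point of index \<open>k\<close>
          and to 0 at the other three. As \<open>C\<close> is closed under ring scalars,
          \<open>e \<cdot>\<^sub>v w\<close> is still in \<open>C\<close>.\<close>
        define e where "e = gray4_inv \<xi> (unit_vec 4 k)"
        have "0 = gray \<xi> v \<bullet> gray \<xi> (e \<cdot>\<^sub>v w)"
          using x xv smult[OF w] by (auto simp: dual_code_def)
        also have "\<dots> = (\<Sum>i<4. gray4 \<xi> (e * (v \<bullet> w)) $ i)"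
          using v wn by (simp add: gray_scalar_prod[OF cube])
        \<comment> \<open>Multiplication by \<open>e\<close> erases every entry except the one at
          \<open>k\<close>.\<close>
        also have "\<dots> = (\<Sum>i<4. if i = k then gray4 \<xi> (v \<bullet> w) $ i else 0)"
          using k by (intro sum.cong)
            (auto simp: e_def gray4_mult_index[OF cube] gray4_gray4_inv[OF \<xi>])
        also have "\<dots> = gray4 \<xi> (v \<bullet> w) $ k"
          using k by simp
        finally show ?thesis by simp
      qed
      \<comment> \<open>With all four entries zero, the left inverse of \<open>gray4\<close> gives
        \<open>v \<bullet> w = 0\<close>.\<close>
      then have "gray4 \<xi> (v \<bullet> w) = gray4 \<xi> 0"
        by (intro eq_vecI) (auto simp: gray4_zero_index)
      then show ?thesis
        by (metis gray4_inv_gray4[OF \<xi>])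
    qed
    then have "v \<in> C"
      using v by (subst dual) (simp add: dual_code_def)
    then show "x \<in> gray \<xi> ` C"
      using xv by simp
  qed
  ultimately show ?thesis
    by (auto simp: self_dual_code_def)
qed

section \<open>Hamming and Gray distances\<close>

text \<open>Since \<open>gray\<close> respects differences, two images disagree exactly at the
  positions where the image of the difference is nonzero.\<close>

lemma hamming_dist_gray:
  assumes "r \<in> carrier_vec n" "s \<in> carrier_vec n"
  shows "hamming_dist (gray \<xi> r) (gray \<xi> s) = gray_dist \<xi> r s"
proof -
  have "gray \<xi> r \<in> carrier_vec (4 * n)" "gray \<xi> s \<in> carrier_vec (4 * n)"
    using assms by simp_all
  then show ?thesis
    unfolding gray_dist_def gray_weight_def gray_diff[OF assms] hamming_dist_def hamming_weight_def
    by (intro arg_cong[where f = card]) auto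
qed

theorem theorem13:
  fixes \<xi> :: "'p :: prime_card mod_ring" and n :: nat
  assumes "[CARD('p) = 1] (mod 3)"
    and "primitive_root_of_unity 3 \<xi>"
  shows "linear_map class_ring
           (restrict_scalars uconst (regular_module :: ('p mod_ring uring, 'p mod_ring uring) module))
           (module_vec TYPE('p mod_ring) 4)
           (gray4 \<xi>)
       \<and> bij_betw (gray4 \<xi>) UNIV (carrier_vec 4)
       \<and> linear_map class_ring
           (restrict_scalars uconst (module_vec TYPE('p mod_ring uring) n))
           (module_vec TYPE('p mod_ring) (4 * n))
           (gray \<xi>)
       \<and> bij_betw (gray \<xi>) (carrier_vec n) (carrier_vec (4 * n))
       \<and> (\<forall>C. self_dual_code n C \<longrightarrow> self_dual_code (4 * n) (gray \<xi> ` C))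
       \<and> (\<forall>r \<in> carrier_vec n. \<forall>s \<in> carrier_vec n.
            hamming_dist (gray \<xi> r) (gray \<xi> s) = gray_dist \<xi> r s)"
proof -
  have "\<xi> ^ 3 = 1"
    using assms(2) by (simp add: primitive_root_of_unity_def)
  then show ?thesis
    using assms(2)
    by (simp add: linear_map_gray4 bij_betw_gray4 linear_map_gray bij_betw_gray self_dual_gray
        hamming_dist_gray)
qed

end
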